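(* Let $\alpha\ge 0$ and $G_\alpha(x)=\dfrac{x^\alpha\,\Gamma(x)}{\Gamma(x+\alpha)}$ for $x>0$. Then the following are equivalent: $G_\alpha$ is logarithmically completely monotone on $(0,\infty)$; $G_\alpha$ is completely monotone on $(0,\infty)$; $0\le\alpha\le 1$.
   Context: A function $f:(0,\infty)\to[0,\infty)$ is completely monotone if $f\in C^\infty$ and $(-1)^n f^{(n)}(x)\ge 0$ for all $n\ge 0$, $x>0$. A positive function $f$ on $(0,\infty)$ is logarithmically completely monotone if $-(\log f)'$ is completely monotone. *)

theory Defs
  imports "HOL-Analysis.Analysis"
begin

text \<open>
  Functions on \<open>(0, \<infinity>)\<close> are rendered as total functions on the reals. Since \<open>(0, \<infinity>)\<close>
  is open, differentiability and \<^const>\<open>deriv\<close> at a point \<open>x > 0\<close> do not depend on the values at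
  arguments \<open>\<le> 0\<close>. As \<^const>\<open>deriv\<close> is unspecified at points where no derivative exists,
  differentiability is always required explicitly.
\<close>

definition completely_monotone :: "(real \<Rightarrow> real) \<Rightarrow> bool" where
  "completely_monotone f \<longleftrightarrow>
     (\<forall>n. \<forall>x>0. (deriv ^^ n) f field_differentiable (at x)) \<and>
     (\<forall>n. \<forall>x>0. (- 1) ^ n * (deriv ^^ n) f x \<ge> 0)"

definition log_completely_monotone :: "(real \<Rightarrow> real) \<Rightarrow> bool" where
  "log_completely_monotone f \<longleftrightarrow>
     (\<forall>x>0. f x > 0) \<and>
     (\<forall>x>0. (\<lambda>t. ln (f t)) field_differentiable (at x)) \<and>
     completely_monotone (\<lambda>x. - deriv (\<lambda>t. ln (f t)) x)"

definition G :: "real \<Rightarrow> real \<Rightarrow> real" where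
  "G \<alpha> x = x powr \<alpha> * Gamma x / Gamma (x + \<alpha>)"

end

theory Submission
  imports Defs
begin

text \<open>
  Three ideas carry the equivalence; together they give the cycle "\<open>0 \<le> \<alpha> \<le> 1\<close> implies logarithmic
  complete monotonicity implies complete monotonicity implies \<open>\<alpha> \<le> 1\<close>".

  For \<open>0 \<le> \<alpha> \<le> 1\<close>, write \<open>\<psi>\<close> for the digamma function, so that
  \<open>- (ln G)' x = \<psi> (x + \<alpha>) - \<psi> x - \<alpha> / x\<close>. Put \<open>f = (-1)\<^sup>n \<psi>\<^sup>(\<^sup>n\<^sup>)\<close>. The signs of the polygamma
  functions make \<open>f\<close> concave, and the recurrence for \<open>\<psi>\<close> gives \<open>f (x + 1) - f x = n! / x\<^sup>n\<^sup>+\<^sup>1\<close>. As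
  \<open>x + \<alpha>\<close> is the convex combination of \<open>x\<close> and \<open>x + 1\<close> with weight \<open>\<alpha>\<close>, concavity yields
  \<open>f (x + \<alpha>) - f x \<ge> \<alpha> n! / x\<^sup>n\<^sup>+\<^sup>1\<close>, which says precisely that the \<open>n\<close>-th derivative of
  \<open>- (ln G)'\<close> has sign \<open>(-1)\<^sup>n\<close> (lemma \<open>polygamma_increment_lower_bound\<close>).

  Logarithmic complete monotonicity implies complete monotonicity for every function \<open>f\<close>: with
  \<open>h = - (ln f)'\<close> we have \<open>- f' = h f\<close>, so if \<open>f\<close> has the right signs up to order \<open>n\<close>, the product
  rule shows that \<open>- f'\<close> does too, that is, \<open>f\<close> has the right signs up to order \<open>n + 1\<close>
  (lemma \<open>log_completely_monotone_imp_completely_monotone\<close>).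

  Finally a completely monotone function is decreasing, hence bounded away from \<open>0\<close> near the origin
  once it is positive somewhere. But \<open>G \<alpha> x = x powr (\<alpha> - 1) * Gamma (x + 1) / Gamma (x + \<alpha>)\<close>
  tends to \<open>0\<close> as \<open>x \<rightarrow> 0\<close> when \<open>\<alpha> > 1\<close>.
\<close>

section \<open>Complete monotonicity up to a finite order\<close>

text \<open>
  The recursion passes to \<open>- f'\<close>, which absorbs the alternating sign. The derivative is existentially
  quantified and prescribed on \<open>(0, \<infinity>)\<close> only, so that convenient representatives can be used.
\<close>

primrec cm_upto :: "nat \<Rightarrow> (real \<Rightarrow> real) \<Rightarrow> bool" where
  "cm_upto 0 f \<longleftrightarrow> (\<forall>x>0. f x \<ge> 0)"
| "cm_upto (Suc n) f \<longleftrightarrow> (\<forall>x>0. f x \<ge> 0) \<and>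
     (\<exists>g. (\<forall>x>0. (f has_real_derivative - g x) (at x)) \<and> cm_upto n g)"

lemma cm_upto_nonneg: "cm_upto n f \<Longrightarrow> x > 0 \<Longrightarrow> f x \<ge> 0"
  by (cases n) auto

lemma cm_upto_SucI:
  assumes "\<And>x. x > 0 \<Longrightarrow> f x \<ge> 0"
    and "\<And>x. x > 0 \<Longrightarrow> (f has_real_derivative - g x) (at x)"
    and "cm_upto n g"
  shows "cm_upto (Suc n) f"
  using assms by auto

lemma cm_upto_Suc_imp_cm_upto: "cm_upto (Suc n) f \<Longrightarrow> cm_upto n f"
proof (induction n arbitrary: f)
  case (Suc n)
  then obtain g where "\<forall>x>0. (f has_real_derivative - g x) (at x)" "cm_upto (Suc n) g"
    by auto
  with Suc show ?case
    by (intro cm_upto_SucI[of f g]) (auto intro: cm_upto_nonneg)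
qed simp

lemma cm_upto_add: "cm_upto n f \<Longrightarrow> cm_upto n g \<Longrightarrow> cm_upto n (\<lambda>x. f x + g x)"
proof (induction n arbitrary: f g)
  case (Suc n)
  obtain f' where f': "\<And>x. x > 0 \<Longrightarrow> (f has_real_derivative - f' x) (at x)" "cm_upto n f'"
    using Suc.prems by auto
  obtain g' where g': "\<And>x. x > 0 \<Longrightarrow> (g has_real_derivative - g' x) (at x)" "cm_upto n g'"
    using Suc.prems by auto
  show ?case
  proof (rule cm_upto_SucI)
    show "((\<lambda>x. f x + g x) has_real_derivative - (f' x + g' x)) (at x)" if "x > 0" for x
      using DERIV_add[OF f'(1)[OF that] g'(1)[OF that]] by (simp add: algebra_simps)
    show "cm_upto n (\<lambda>x. f' x + g' x)"
      using f'(2) g'(2) by (rule Suc.IH)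
  qed (use Suc.prems in \<open>auto intro!: add_nonneg_nonneg\<close>)
qed simp

lemma cm_upto_mult: "cm_upto n f \<Longrightarrow> cm_upto n g \<Longrightarrow> cm_upto n (\<lambda>x. f x * g x)"
proof (induction n arbitrary: f g)
  case (Suc n)
  obtain f' where f': "\<And>x. x > 0 \<Longrightarrow> (f has_real_derivative - f' x) (at x)" "cm_upto n f'"
    using Suc.prems by auto
  obtain g' where g': "\<And>x. x > 0 \<Longrightarrow> (g has_real_derivative - g' x) (at x)" "cm_upto n g'"
    using Suc.prems by auto
  show ?case
  proof (rule cm_upto_SucI)
    show "((\<lambda>x. f x * g x) has_real_derivative - (f' x * g x + f x * g' x)) (at x)"
      if "x > 0" for x
      using DERIV_mult[OF f'(1)[OF that] g'(1)[OF that]] by (simp add: algebra_simps)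
    show "cm_upto n (\<lambda>x. f' x * g x + f x * g' x)"
      using Suc.prems f'(2) g'(2)
      by (intro cm_upto_add Suc.IH) (auto intro: cm_upto_Suc_imp_cm_upto simp del: cm_upto.simps)
  qed (use Suc.prems in \<open>auto intro!: mult_nonneg_nonneg\<close>)
qed simp

text \<open>
  For functions whose derivatives of every order are known, one names all the signed derivatives
  \<open>F k = (-1)\<^sup>k f\<^sup>(\<^sup>k\<^sup>)\<close> at once; the statement is about every \<open>k\<close> because the induction shifts \<open>k\<close>.
\<close>

lemma cm_upto_if_derivative_sequence:
  assumes "\<And>k x. x > 0 \<Longrightarrow> F k x \<ge> 0"
    and "\<And>k x. x > 0 \<Longrightarrow> (F k has_real_derivative - F (Suc k) x) (at x)"
  shows "cm_upto n (F k)"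
proof (induction n arbitrary: k)
  case (Suc n)
  show ?case
    using assms Suc.IH[of "Suc k"] by (intro cm_upto_SucI[of "F k" "F (Suc k)"])
qed (use assms in auto)

lemma cm_upto_higher_deriv:
  assumes "cm_upto n f" "k \<le> n"
  shows "\<exists>g. cm_upto (n - k) g \<and> (\<forall>x>0. (deriv ^^ k) f x = (- 1) ^ k * g x)"
  using assms(2)
proof (induction k)
  case 0
  with assms(1) show ?case by auto
next
  case (Suc k)
  then obtain g where g: "cm_upto (n - k) g" "\<And>x. x > 0 \<Longrightarrow> (deriv ^^ k) f x = (- 1) ^ k * g x"
    by auto
  have "n - k = Suc (n - Suc k)"
    using Suc.prems by simp
  with g(1) obtain g' where g': "\<And>x. x > 0 \<Longrightarrow> (g has_real_derivative - g' x) (at x)"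
      "cm_upto (n - Suc k) g'"
    by auto
  have "(deriv ^^ Suc k) f x = (- 1) ^ Suc k * g' x" if "x > 0" for x
  proof -
    have "((\<lambda>x. (- 1) ^ k * g x) has_real_derivative (- 1) ^ k * - g' x) (at x)"
      using g'(1)[OF that] by (rule DERIV_cmult)
    then have "((deriv ^^ k) f has_real_derivative (- 1) ^ k * - g' x) (at x)"
      by (rule has_field_derivative_transform_within_open[where S = "{0<..}"])
        (use that g(2) in auto)
    then show ?thesis
      by (simp add: DERIV_imp_deriv)
  qed
  with g'(2) show ?case by blast
qed

text \<open>
  Replaces iterated derivatives by the recursion on the order, in which closure under products needs
  only the ordinary product rule instead of the Leibniz formula for higher derivatives.
\<close>

lemma completely_monotone_iff_cm_upto: "completely_monotone f \<longleftrightarrow> (\<forall>n. cm_upto n f)"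
proof
  assume f: "completely_monotone f"
  define F where "F k x = (- 1) ^ k * (deriv ^^ k) f x" for k x
  have "cm_upto n (F 0)" for n
  proof (rule cm_upto_if_derivative_sequence)
    show "F k x \<ge> 0" if "x > 0" for k x
      using f that by (auto simp: completely_monotone_def F_def)
    show "(F k has_real_derivative - F (Suc k) x) (at x)" if "x > 0" for k x
    proof -
      have "((deriv ^^ k) f has_real_derivative deriv ((deriv ^^ k) f) x) (at x)"
        using f that by (auto simp: completely_monotone_def field_differentiable_derivI)
      then have "((\<lambda>x. (- 1) ^ k * (deriv ^^ k) f x) has_real_derivative
          (- 1) ^ k * deriv ((deriv ^^ k) f) x) (at x)"
        by (rule DERIV_cmult)
      then show ?thesis
        by (simp add: F_def[abs_def])
    qed
  qed
  moreover have "F 0 = f"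
    by (simp add: F_def[abs_def])
  ultimately show "\<forall>n. cm_upto n f" by simp
next
  assume f: "\<forall>n. cm_upto n f"
  show "completely_monotone f"
    unfolding completely_monotone_def
  proof (intro conjI allI impI)
    fix n and x :: real
    assume x: "x > 0"
    \<comment> \<open>One order beyond \<open>n\<close> makes the \<open>n\<close>-th derivative differentiable.\<close>
    from cm_upto_higher_deriv[of "Suc n" f n] f obtain g
      where g: "cm_upto (Suc 0) g" "\<And>x. x > 0 \<Longrightarrow> (deriv ^^ n) f x = (- 1) ^ n * g x"
      by auto
    show "(- 1) ^ n * (deriv ^^ n) f x \<ge> 0"
      using g(2)[OF x] cm_upto_nonneg[OF g(1) x] by simp
    from g(1) x obtain d where "(g has_real_derivative d) (at x)"
      by auto
    then have "((\<lambda>x. (- 1) ^ n * g x) has_real_derivative (- 1) ^ n * d) (at x)"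
      by (rule DERIV_cmult)
    then have "((deriv ^^ n) f has_real_derivative (- 1) ^ n * d) (at x)"
      by (rule has_field_derivative_transform_within_open[where S = "{0<..}"])
        (use x g(2) in auto)
    then show "(deriv ^^ n) f field_differentiable at x"
      by (auto simp: field_differentiable_def)
  qed
qed

lemma completely_monotone_cong:
  assumes "completely_monotone f" "\<And>x. x > 0 \<Longrightarrow> f x = g x"
  shows "completely_monotone g"
proof -
  have "cm_upto n g" for n
  proof (cases n)
    case 0
    have "cm_upto 0 f"
      using assms(1) by (simp only: completely_monotone_iff_cm_upto)
    with 0 assms(2) show ?thesis by auto
  next
    case (Suc m)
    have "cm_upto (Suc m) f"
      using assms(1) by (simp only: completely_monotone_iff_cm_upto)
    then obtain f' where f': "\<And>x. x > 0 \<Longrightarrow> f x \<ge> 0"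
        "\<And>x. x > 0 \<Longrightarrow> (f has_real_derivative - f' x) (at x)" "cm_upto m f'"
      by auto
    have "(g has_real_derivative - f' x) (at x)" if "x > 0" for x
      using f'(2)[OF that]
      by (rule has_field_derivative_transform_within_open[where S = "{0<..}"])
        (use that assms(2) in auto)
    with Suc f' assms(2) show ?thesis
      by (intro cm_upto_SucI[of g f' m, folded Suc]) auto
  qed
  then show ?thesis
    by (simp add: completely_monotone_iff_cm_upto)
qed

lemma completely_monotone_antimono:
  assumes "completely_monotone f" "0 < x" "x \<le> y"
  shows "f y \<le> f x"
proof -
  have "cm_upto (Suc 0) f"
    using assms(1) by (simp only: completely_monotone_iff_cm_upto)
  then obtain g where g: "\<forall>x>0. (f has_real_derivative - g x) (at x)" "cm_upto 0 g"
    by auto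
  show ?thesis
  proof (rule DERIV_nonpos_imp_nonincreasing[OF \<open>x \<le> y\<close>])
    fix t
    assume "x \<le> t" "t \<le> y"
    with assms(2) have "t > 0" by simp
    with g show "\<exists>d. (f has_real_derivative d) (at t) \<and> d \<le> 0"
      by (intro exI[of _ "- g t"]) auto
  qed
qed

text \<open>
  The differential equation \<open>- f' = h f\<close> with \<open>h = - (ln f)'\<close> lifts the order one step at a time.
\<close>

theorem log_completely_monotone_imp_completely_monotone:
  assumes "log_completely_monotone f"
  shows "completely_monotone f"
proof -
  define h where "h x = - deriv (\<lambda>t. ln (f t)) x" for x
  have pos: "f x > 0" if "x > 0" for x
    using assms that by (auto simp: log_completely_monotone_def)
  have h: "cm_upto n h" for n
    using assms by (simp add: log_completely_monotone_def h_def[abs_def] completely_monotone_iff_cm_upto)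
  have deriv_f: "(f has_real_derivative - (h x * f x)) (at x)" if "x > 0" for x
  proof -
    have "((\<lambda>t. ln (f t)) has_real_derivative - h x) (at x)"
      using assms that by (simp add: log_completely_monotone_def h_def field_differentiable_derivI)
    then have "((\<lambda>t. exp (ln (f t))) has_real_derivative exp (ln (f x)) * - h x) (at x)"
      by (rule DERIV_fun_exp)
    then have "(f has_real_derivative exp (ln (f x)) * - h x) (at x)"
      by (rule has_field_derivative_transform_within_open[where S = "{0<..}"])
        (use that pos in auto)
    then show ?thesis
      using pos[OF that] by (simp add: mult.commute)
  qed
  have "cm_upto n f" for n
  proof (induction n)
    case 0
    then show ?case
      using pos by (auto intro: less_imp_le)
  next
    case (Suc n)
    show ?case
      using pos deriv_f cm_upto_mult[OF h Suc]
      by (intro cm_upto_SucI[of f "\<lambda>x. h x * f x"]) (auto intro: less_imp_le)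
  qed
  then show ?thesis
    by (simp add: completely_monotone_iff_cm_upto)
qed

section \<open>Increments of the polygamma functions\<close>

text \<open>
  The second derivative is \<open>(-1)\<^sup>n\<close> times the polygamma function of order \<open>n + 2 > 0\<close>, whose sign is
  opposite to \<open>(-1)\<^sup>n\<close>.
\<close>

lemma concave_on_signed_Polygamma:
  "concave_on {0<..} (\<lambda>x::real. (- 1) ^ n * Polygamma n x)"
proof (rule f''_le0_imp_concave)
  fix x :: real
  assume "x \<in> {0<..}"
  then have x: "x > 0" "x \<notin> \<int>\<^sub>\<le>\<^sub>0"
    by (auto elim!: nonpos_Ints_cases)
  show "((\<lambda>x. (- 1) ^ n * Polygamma n x) has_real_derivative (- 1) ^ n * Polygamma (Suc n) x) (at x)"
    by (intro DERIV_cmult has_field_derivative_Polygamma x)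
  show "((\<lambda>x. (- 1) ^ n * Polygamma (Suc n) x) has_real_derivative
      (- 1) ^ n * Polygamma (Suc (Suc n)) x) (at x)"
    by (intro DERIV_cmult has_field_derivative_Polygamma x)
  show "(- 1) ^ n * Polygamma (Suc (Suc n)) x \<le> 0"
    using Polygamma_real_odd_pos[of x "Suc (Suc n)"] Polygamma_real_even_neg[of x "Suc (Suc n)"] x
    by (cases "even n") (auto intro: less_imp_le)
qed auto

text \<open>
  The chord of a concave function over \<open>[x, x + 1]\<close> lies below its graph, and the recurrence of the
  polygamma functions evaluates the slope of that chord.
\<close>

lemma polygamma_increment_lower_bound:
  fixes x \<alpha> :: real
  assumes "x > 0" "0 \<le> \<alpha>" "\<alpha> \<le> 1"
  shows "\<alpha> * fact n / x ^ Suc n \<le> (- 1) ^ n * (Polygamma n (x + \<alpha>) - Polygamma n x)"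
proof -
  define f where "f x = (- 1) ^ n * Polygamma n x" for x :: real
  have step: "f (x + 1) = f x + fact n / x ^ Suc n"
    using assms(1) by (simp add: f_def Polygamma_plus1 ring_distribs flip: power_add mult_2)
  have "(1 - \<alpha>) * f x + \<alpha> * f (x + 1) \<le> f ((1 - \<alpha>) *\<^sub>R x + \<alpha> *\<^sub>R (x + 1))"
    using concave_on_signed_Polygamma[of n] assms unfolding f_def[abs_def]
    by (intro concave_onD) auto
  also have "(1 - \<alpha>) *\<^sub>R x + \<alpha> *\<^sub>R (x + 1) = x + \<alpha>"
    by (simp add: algebra_simps)
  finally have "\<alpha> * (fact n / x ^ Suc n) \<le> f (x + \<alpha>) - f x"
    unfolding step by (simp add: algebra_simps)
  then show ?thesis
    by (simp add: f_def algebra_simps)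
qed

section \<open>The function \<open>G \<alpha>\<close>\<close>

lemma G_pos: "\<alpha> \<ge> 0 \<Longrightarrow> x > 0 \<Longrightarrow> G \<alpha> x > 0"
  by (simp add: G_def)

lemma has_real_derivative_ln_G:
  assumes "\<alpha> \<ge> 0" "x > 0"
  shows "((\<lambda>t. ln (G \<alpha> t)) has_real_derivative
     - (Digamma (x + \<alpha>) - Digamma x - \<alpha> / x)) (at x)"
proof -
  have "((\<lambda>t. \<alpha> * ln t + ln_Gamma t - ln_Gamma (t + \<alpha>)) has_real_derivative
      - (Digamma (x + \<alpha>) - Digamma x - \<alpha> / x)) (at x)"
    using assms
    by (auto intro!: derivative_eq_intros DERIV_chain2[OF has_field_derivative_ln_Gamma_real])
  then show ?thesis
  proof (rule has_field_derivative_transform_within_open[where S = "{0<..}"])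
    fix t :: real
    assume "t \<in> {0<..}"
    then have t: "t > 0" by simp
    then have "Gamma t \<noteq> 0" "Gamma (t + \<alpha>) \<noteq> 0"
      using assms Gamma_real_pos[of t] Gamma_real_pos[of "t + \<alpha>"] by linarith+
    with t assms show "\<alpha> * ln t + ln_Gamma t - ln_Gamma (t + \<alpha>) = ln (G \<alpha> t)"
      by (simp add: G_def ln_Gamma_real_pos ln_div ln_mult ln_powr)
  qed (use assms in auto)
qed

lemma log_completely_monotone_G:
  assumes "0 \<le> \<alpha>" "\<alpha> \<le> 1"
  shows "log_completely_monotone (G \<alpha>)"
proof -
  \<comment> \<open>\<open>H k\<close> is \<open>(-1)\<^sup>k\<close> times the \<open>k\<close>-th derivative of \<open>- (ln G)'\<close>.\<close>
  define H where "H k x = (- 1) ^ k * (Polygamma k (x + \<alpha>) - Polygamma k x) - \<alpha> * fact k / x ^ Suc k"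
    for k and x :: real
  have "cm_upto n (H 0)" for n
  proof (rule cm_upto_if_derivative_sequence)
    show "H k x \<ge> 0" if "x > 0" for k x
      using polygamma_increment_lower_bound[OF that assms] by (simp add: H_def)
    show "(H k has_real_derivative - H (Suc k) x) (at x)" if x: "x > 0" for k x
    proof -
      have nonpole: "x \<notin> \<int>\<^sub>\<le>\<^sub>0" "x + \<alpha> \<notin> \<int>\<^sub>\<le>\<^sub>0"
        using x assms by (auto elim!: nonpos_Ints_cases)
      have "((\<lambda>x. Polygamma k (x + \<alpha>)) has_real_derivative Polygamma (Suc k) (x + \<alpha>)) (at x)"
        using nonpole by (auto intro!: derivative_eq_intros)
      from DERIV_diff[OF this has_field_derivative_Polygamma[OF nonpole(1)]]
      have 1: "((\<lambda>x. (- 1) ^ k * (Polygamma k (x + \<alpha>) - Polygamma k x)) has_real_derivative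
          (- 1) ^ k * (Polygamma (Suc k) (x + \<alpha>) - Polygamma (Suc k) x)) (at x)"
        by (rule DERIV_cmult)
      have 2: "((\<lambda>x. \<alpha> * fact k / x ^ Suc k) has_real_derivative
          - (\<alpha> * fact (Suc k) / x ^ Suc (Suc k))) (at x)"
        using x by (auto intro!: derivative_eq_intros simp del: power_Suc)
          (simp add: field_simps)
      show ?thesis
        using DERIV_diff[OF 1 2] unfolding H_def[abs_def] by (simp add: algebra_simps)
    qed
  qed
  then have "completely_monotone (H 0)"
    by (simp add: completely_monotone_iff_cm_upto)
  moreover have "H 0 x = - deriv (\<lambda>t. ln (G \<alpha> t)) x" if "x > 0" for x
    using DERIV_imp_deriv[OF has_real_derivative_ln_G[OF assms(1) that]] by (simp add: H_def)
  ultimately have "completely_monotone (\<lambda>x. - deriv (\<lambda>t. ln (G \<alpha> t)) x)"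
    by (rule completely_monotone_cong)
  then show ?thesis
    using G_pos[OF assms(1)] has_real_derivative_ln_G[OF assms(1)]
    by (auto simp: log_completely_monotone_def field_differentiable_def)
qed

text \<open>
  The pole of the gamma function at \<open>0\<close> is simple, so the factor \<open>x powr \<alpha>\<close> overcompensates it.
\<close>

lemma G_tendsto_0_at_right_0:
  assumes "\<alpha> > 1"
  shows "(G \<alpha> \<longlongrightarrow> 0) (at_right 0)"
proof -
  have "((\<lambda>x::real. x powr (\<alpha> - 1)) \<longlongrightarrow> 0 powr (\<alpha> - 1)) (at_right 0)"
    by (rule tendsto_powr') (use assms in \<open>auto intro!: tendsto_intros simp: eventually_at_filter\<close>)
  then have "((\<lambda>x. x powr (\<alpha> - 1)) \<longlongrightarrow> 0) (at_right (0::real))"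
    by simp
  moreover have "((\<lambda>x. Gamma (x + 1) / Gamma (x + \<alpha>)) \<longlongrightarrow> Gamma (0 + 1) / Gamma (0 + \<alpha>))
      (at_right 0)"
    using assms by (intro tendsto_intros) (auto elim!: nonpos_Ints_cases simp: Gamma_eq_zero_iff)
  ultimately have "((\<lambda>x. x powr (\<alpha> - 1) * (Gamma (x + 1) / Gamma (x + \<alpha>))) \<longlongrightarrow>
      0 * (Gamma (0 + 1) / Gamma (0 + \<alpha>))) (at_right 0)"
    by (rule tendsto_mult)
  moreover have "\<forall>\<^sub>F x in at_right 0. x powr (\<alpha> - 1) * (Gamma (x + 1) / Gamma (x + \<alpha>)) = G \<alpha> x"
    using eventually_at_right_less[of 0]
  proof eventually_elim
    case (elim x)
    then have "Gamma (x + 1) = x * Gamma x"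
      by (intro Gamma_plus1) (auto elim!: nonpos_Ints_cases)
    moreover have "x powr \<alpha> = x powr (\<alpha> - 1) * x"
      using elim by (simp add: powr_diff)
    ultimately show ?case
      by (simp add: G_def)
  qed
  ultimately show ?thesis
    using tendsto_cong by fastforce
qed

lemma completely_monotone_G_imp_le_1:
  assumes "\<alpha> \<ge> 0" "completely_monotone (G \<alpha>)"
  shows "\<alpha> \<le> 1"
proof (rule ccontr)
  assume "\<not> \<alpha> \<le> 1"
  then have lim: "(G \<alpha> \<longlongrightarrow> 0) (at_right 0)"
    by (intro G_tendsto_0_at_right_0) simp
  have "\<forall>\<^sub>F x in at_right 0. G \<alpha> 1 \<le> G \<alpha> x"
    using eventually_at_right_less[of 0] eventually_at_right_real[of 0 1, OF zero_less_one]
    by eventually_elim (use completely_monotone_antimono[OF assms(2)] in auto)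
  with lim have "G \<alpha> 1 \<le> 0"
    by (intro tendsto_lowerbound) auto
  with G_pos[OF assms(1), of 1] show False by simp
qed

theorem corollary3p5:
  fixes \<alpha> :: real
  assumes "\<alpha> \<ge> 0"
  shows "(log_completely_monotone (G \<alpha>) \<longleftrightarrow> completely_monotone (G \<alpha>)) \<and>
         (completely_monotone (G \<alpha>) \<longleftrightarrow> 0 \<le> \<alpha> \<and> \<alpha> \<le> 1)"
  using assms log_completely_monotone_G[of \<alpha>] completely_monotone_G_imp_le_1[of \<alpha>]
    log_completely_monotone_imp_completely_monotone[of "G \<alpha>"]
  by blast

end
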